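(* Let $P_0\in\mathbb{C}[z]$ be a polynomial of degree $d\ge1$ and, for $j=0,1,\dots,d-1$, let $F_j$ be the entire function $F_j(z)=\int_0^z t^je^{P_0(t)}\,dt$. Let $\mathbb{K}_{P_0}=\mathbb{C}(z)(F_0,\dots,F_{d-1})=\mathbb{C}(z,F_0,\dots,F_{d-1})$ be the field generated by $F_0,\dots,F_{d-1}$ over $\mathbb{C}(z)$. Then $\mathbb{K}_{P_0}$ is the field of fractions of the ring $\mathbb{A}_{P_0}=\mathbb{C}[z][F_0,\dots,F_{d-1}]$, and $\mathbb{K}_{P_0}$ has transcendence degree $d$ over $\mathbb{C}(z)$.
   Context: All functions are regarded as elements of the field of meromorphic functions on $\mathbb{C}$. *)

theory Defs
  imports
    "HOL-Algebra.Generated_Fields"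
    "HOL-Algebra.Finite_Extensions"
    "HOL-Algebra.Indexed_Polynomials"
    "HOL-Complex_Analysis.Complex_Analysis"
begin

section \<open>The field of meromorphic functions on the complex plane\<close>

text \<open>
  A meromorphic function is represented by its unique representative that is
  continuous at every removable singularity and has the value 0 at every pole;
  sums and products are computed pointwise and then normalised by
  \<^const>\<open>remove_sings\<close>. An entire function is its own representative.
\<close>

definition mero :: "(complex \<Rightarrow> complex) ring" where
  "mero =
    \<lparr> carrier = {f. f nicely_meromorphic_on UNIV},
      monoid.mult = (\<lambda>f g. remove_sings (\<lambda>z. f z * g z)),
      one = (\<lambda>_. 1),
      zero = (\<lambda>_. 0),
      add = (\<lambda>f g. remove_sings (\<lambda>z. f z + g z)) \<rparr>"

lemma mero_simps:
  "carrier mero = {f. f nicely_meromorphic_on UNIV}"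
  "f \<otimes>\<^bsub>mero\<^esub> g = remove_sings (\<lambda>z. f z * g z)"
  "\<one>\<^bsub>mero\<^esub> = (\<lambda>_. 1)"
  "\<zero>\<^bsub>mero\<^esub> = (\<lambda>_. 0)"
  "f \<oplus>\<^bsub>mero\<^esub> g = remove_sings (\<lambda>z. f z + g z)"
  by (simp_all add: mero_def)

lemma remove_sings_nicely_meromorphic_id:
  assumes "f nicely_meromorphic_on UNIV"
  shows "remove_sings f = f"
proof
  fix z
  have "is_pole f z \<and> f z = 0 \<or> f \<midarrow>z\<rightarrow> f z"
    using assms by (auto simp: nicely_meromorphic_on_def)
  then show "remove_sings f z = f z"
    by (auto intro: remove_sings_eqI)
qed

lemma remove_sings_eqI_at:
  assumes "\<And>z. eventually (\<lambda>w. f w = g w) (at z)"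
  shows "remove_sings f = remove_sings g"
  using assms by (intro ext remove_sings_cong) auto

lemma eventually_remove_sings_meromorphic:
  assumes "f meromorphic_on UNIV"
  shows "eventually (\<lambda>w. remove_sings f w = f w) (at z)"
proof -
  have "f meromorphic_on {z}"
    using assms by (rule meromorphic_on_subset) simp
  then show ?thesis
    by (intro eventually_remove_sings_eq_at) (simp add: meromorphic_at_iff)
qed

lemma nicely_imp_meromorphic:
  "f nicely_meromorphic_on A \<Longrightarrow> f meromorphic_on A"
  by (simp add: nicely_meromorphic_on_def)

lemma field_mero: "field mero"
proof -
  note [simp] = mero_simps remove_sings_nicely_meromorphic_id
  note [dest] = nicely_imp_meromorphic
  note [intro] = remove_sings_nicely_meromorphic
  note ev = eventually_remove_sings_meromorphic
  have cring: "cring mero"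
  proof (rule cringI)
    show "abelian_group mero"
    proof (rule abelian_groupI)
      fix f g h
      assume "f \<in> carrier mero" "g \<in> carrier mero" "h \<in> carrier mero"
      then have m: "f meromorphic_on UNIV" "g meromorphic_on UNIV" "h meromorphic_on UNIV"
        by auto
      have "remove_sings (\<lambda>z. remove_sings (\<lambda>z. f z + g z) z + h z) = remove_sings (\<lambda>z. f z + g z + h z)"
        by (rule remove_sings_eqI_at, rule eventually_mono, rule ev[of "\<lambda>z. f z + g z"])
           (use m in \<open>auto intro!: meromorphic_intros\<close>)
      moreover have "remove_sings (\<lambda>z. f z + remove_sings (\<lambda>z. g z + h z) z) = remove_sings (\<lambda>z. f z + (g z + h z))"
        by (rule remove_sings_eqI_at, rule eventually_mono, rule ev[of "\<lambda>z. g z + h z"])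
           (use m in \<open>auto intro!: meromorphic_intros\<close>)
      ultimately show "f \<oplus>\<^bsub>mero\<^esub> g \<oplus>\<^bsub>mero\<^esub> h = f \<oplus>\<^bsub>mero\<^esub> (g \<oplus>\<^bsub>mero\<^esub> h)"
        by (simp add: add.assoc)
    next
      fix f assume f: "f \<in> carrier mero"
      have "(\<lambda>z. - f z) nicely_meromorphic_on UNIV"
        using f by (auto intro: nicely_meromorphic_on_uminus)
      then show "\<exists>g\<in>carrier mero. g \<oplus>\<^bsub>mero\<^esub> f = \<zero>\<^bsub>mero\<^esub>"
        by (intro bexI[of _ "\<lambda>z. - f z"]) auto
    qed (auto intro!: meromorphic_intros remove_sings_nicely_meromorphic simp: add.commute)
    show "comm_monoid mero"
    proof (rule comm_monoidI)
      fix f g h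
      assume "f \<in> carrier mero" "g \<in> carrier mero" "h \<in> carrier mero"
      then have m: "f meromorphic_on UNIV" "g meromorphic_on UNIV" "h meromorphic_on UNIV"
        by auto
      have "remove_sings (\<lambda>z. remove_sings (\<lambda>z. f z * g z) z * h z) = remove_sings (\<lambda>z. f z * g z * h z)"
        by (rule remove_sings_eqI_at, rule eventually_mono, rule ev[of "\<lambda>z. f z * g z"])
           (use m in \<open>auto intro!: meromorphic_intros\<close>)
      moreover have "remove_sings (\<lambda>z. f z * remove_sings (\<lambda>z. g z * h z) z) = remove_sings (\<lambda>z. f z * (g z * h z))"
        by (rule remove_sings_eqI_at, rule eventually_mono, rule ev[of "\<lambda>z. g z * h z"])
           (use m in \<open>auto intro!: meromorphic_intros\<close>)
      ultimately show "f \<otimes>\<^bsub>mero\<^esub> g \<otimes>\<^bsub>mero\<^esub> h = f \<otimes>\<^bsub>mero\<^esub> (g \<otimes>\<^bsub>mero\<^esub> h)"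
        by (simp add: mult.assoc)
    qed (auto intro!: meromorphic_intros remove_sings_nicely_meromorphic simp: mult.commute)
    fix f g h
    assume "f \<in> carrier mero" "g \<in> carrier mero" "h \<in> carrier mero"
    then have m: "f meromorphic_on UNIV" "g meromorphic_on UNIV" "h meromorphic_on UNIV"
      by auto
    have "remove_sings (\<lambda>z. remove_sings (\<lambda>z. f z + g z) z * h z) = remove_sings (\<lambda>z. (f z + g z) * h z)"
      by (rule remove_sings_eqI_at, rule eventually_mono, rule ev[of "\<lambda>z. f z + g z"])
         (use m in \<open>auto intro!: meromorphic_intros\<close>)
    moreover have "remove_sings (\<lambda>z. remove_sings (\<lambda>z. f z * h z) z + remove_sings (\<lambda>z. g z * h z) z)
        = remove_sings (\<lambda>z. f z * h z + g z * h z)"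
      by (rule remove_sings_eqI_at,
          rule eventually_elim2[OF ev[of "\<lambda>z. f z * h z"] ev[of "\<lambda>z. g z * h z"]])
         (use m in \<open>auto intro!: meromorphic_intros\<close>)
    ultimately show "(f \<oplus>\<^bsub>mero\<^esub> g) \<otimes>\<^bsub>mero\<^esub> h = f \<otimes>\<^bsub>mero\<^esub> h \<oplus>\<^bsub>mero\<^esub> g \<otimes>\<^bsub>mero\<^esub> h"
      by (simp add: ring_distribs)
  qed
  show ?thesis
  proof (rule cring.cring_fieldI2[OF cring])
    show "\<zero>\<^bsub>mero\<^esub> \<noteq> \<one>\<^bsub>mero\<^esub>"
      by (auto simp: fun_eq_iff)
    fix f assume f: "f \<in> carrier mero" and nz: "f \<noteq> \<zero>\<^bsub>mero\<^esub>"
    have "(\<forall>x\<in>UNIV. f x = 0) \<or> (\<forall>\<^sub>\<approx>x\<in>UNIV. f x \<noteq> 0)"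
      by (rule nicely_meromorphic_imp_constant_or_avoid) (use f in auto)
    with nz have ne: "\<forall>\<^sub>\<approx>x\<in>UNIV. f x \<noteq> 0"
      by auto
    have nz': "eventually (\<lambda>w. f w \<noteq> 0) (at z)" for z
      using eventually_cosparse_imp_eventually_at[OF ne, of z UNIV] by simp
    have "remove_sings (\<lambda>z. f z * inverse (f z)) = remove_sings (\<lambda>_. 1)"
      by (rule remove_sings_eqI_at, rule eventually_mono, rule nz') auto
    then show "\<exists>g\<in>carrier mero. f \<otimes>\<^bsub>mero\<^esub> g = \<one>\<^bsub>mero\<^esub>"
      using f by (intro bexI[of _ "\<lambda>z. inverse (f z)"])
        (auto intro: nicely_meromorphic_on_inverse)
  qed
qed


section \<open>Fraction fields and transcendence degree inside an ambient field\<close>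

definition (in ring) is_fraction_field :: "'a set \<Rightarrow> 'a set \<Rightarrow> bool" where
  "is_fraction_field A K \<longleftrightarrow>
    subring A R \<and> subfield K R \<and> A \<subseteq> K \<and>
    (\<forall>x\<in>K. \<exists>a\<in>A. \<exists>b\<in>A - {\<zero>}. x = a \<otimes> inv b)"

text \<open>
  Polynomials with variables indexed by a set \<open>B\<close> of ring elements, evaluated by
  substituting each element of \<open>B\<close> for its own variable. A monomial is a multiset
  of variables, as in \<^theory>\<open>HOL-Algebra.Indexed_Polynomials\<close>.
\<close>

definition (in ring) indexed_subst :: "('a multiset \<Rightarrow> 'a) \<Rightarrow> 'a" where
  "indexed_subst P =
    (\<Oplus>m\<in>{m. P m \<noteq> \<zero>}. P m \<otimes> (\<Otimes>b\<in>set_mset m. b [^] count m b))"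

definition (in ring) algebraically_independent :: "'a set \<Rightarrow> 'a set \<Rightarrow> bool" where
  "algebraically_independent K B \<longleftrightarrow>
    (\<forall>P \<in> indexed_pset B K. indexed_subst P = \<zero> \<longrightarrow> P = indexed_const \<zero>)"

definition (in ring) transcendence_basis :: "'a set \<Rightarrow> 'a set \<Rightarrow> 'a set \<Rightarrow> bool" where
  "transcendence_basis K L B \<longleftrightarrow>
    B \<subseteq> L \<and> algebraically_independent K B \<and>
    (\<forall>x\<in>L. (algebraic over (generate_field R (K \<union> B))) x)"

definition (in ring) has_transcendence_degree :: "'a set \<Rightarrow> 'a set \<Rightarrow> nat \<Rightarrow> bool" where
  "has_transcendence_degree K L n \<longleftrightarrow>
    subfield K R \<and> subfield L R \<and> K \<subseteq> L \<and>
    (\<exists>B. transcendence_basis K L B \<and> finite B \<and> card B = n)"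


section \<open>The ring and field generated by the exponential integrals\<close>

definition polynomial_functions :: "(complex \<Rightarrow> complex) set" where
  "polynomial_functions = range poly"

definition rational_functions :: "(complex \<Rightarrow> complex) set" where
  "rational_functions = {remove_sings (\<lambda>z. poly p z / poly q z) | p q. q \<noteq> 0}"

definition F :: "complex poly \<Rightarrow> nat \<Rightarrow> complex \<Rightarrow> complex" where
  "F P0 j z = contour_integral (linepath 0 z) (\<lambda>t. t ^ j * exp (poly P0 t))"

definition A_ring :: "complex poly \<Rightarrow> (complex \<Rightarrow> complex) set" where
  "A_ring P0 = generate_ring mero (polynomial_functions \<union> F P0 ` {..<Polynomial.degree P0})"

definition K_field :: "complex poly \<Rightarrow> (complex \<Rightarrow> complex) set" where
  "K_field P0 = generate_field mero (rational_functions \<union> F P0 ` {..<Polynomial.degree P0})"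

end

theory Submission
  imports
    Defs
    "HOL-Computational_Algebra.Polynomial_Factorial"
    "HOL-Computational_Algebra.Field_as_Ring"
begin

text \<open>
  Write \<open>G = exp P0\<close> and \<open>p = P0'\<close>, so that \<open>G' = p G\<close> and \<open>F_j' = z^j G\<close>. Since \<open>p\<close> is a
  combination of \<open>1, ..., z^(d-1)\<close> whose coefficient at \<open>z^(d-1)\<close> is nonzero, \<open>G\<close> is a constant
  plus a combination of \<open>F_0, ..., F_(d-1)\<close> in which \<open>F_(d-1)\<close> occurs. Hence \<open>G\<close> can replace
  \<open>F_(d-1)\<close> as a generator, and the transcendence degree is \<open>d\<close> as soon as
  \<open>G, F_0, ..., F_(d-2)\<close> are algebraically independent over \<open>\<complex>(z)\<close>.

  For the independence, let a polynomial relation between these functions have polynomial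
  coefficients, and order relations by the degree in the integrals \<open>F_j\<close> and then by the number
  of monomials of that degree. Differentiation turns relations into relations; it replaces a
  factor \<open>F_j\<close> by \<open>z^j G\<close> and therefore never creates monomials of top degree in the integrals.
  If \<open>a\<close> is the coefficient of one top monomial, in which \<open>G\<close> occurs \<open>k\<close> times, then
  \<open>a\<close> times the derivative minus \<open>a' + k p a\<close> times the relation is a smaller relation. In a
  minimal counterexample it must vanish \<^emph>\<open>formally\<close>, coefficient by coefficient. On the top
  monomials this forces every coefficient to be a constant multiple of \<open>a\<close>, and zero unless \<open>G\<close>
  occurs exactly \<open>k\<close> times. One degree lower, it produces a rational solution of
  \<open>y' + p y + q = 0\<close> where \<open>q\<close> is a nontrivial constant combination of the \<open>z^j\<close> with
  \<open>j \<le> d - 2\<close>. Such a solution has no poles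
  (\<open>rational_solution_is_polynomial\<close>), and comparing degrees excludes a polynomial solution
  (\<open>polynomial_solution_trivial\<close>), because \<open>deg q < d - 1 = deg p\<close>. So no integrals occur in
  the relation at all, and what is left is \<open>a G^k = 0\<close>, which is absurd. This is
  \<open>no_algebraic_relation\<close>; \<open>algebraically_independentI\<close> carries it to the field of meromorphic
  functions by clearing denominators.

  The assertion on fields of fractions is formal: the quotients of elements of a subring are
  closed under the field operations (\<open>generate_field_fractions\<close>).
\<close>

section \<open>Polynomial and rational solutions of a first-order linear equation\<close>

lemma coprime_dvd_pderiv_imp_const:
  fixes u v :: "complex poly"
  assumes "coprime u v" "v dvd pderiv v * u"
  shows "pderiv v = 0"
proof -
  from assms have "v dvd pderiv v"
    by (simp add: coprime_commute coprime_dvd_mult_left_iff)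
  then show ?thesis
    using not_dvd_pderiv[of v] by (auto simp: pderiv_eq_0_iff)
qed

text \<open>
  The hypothesis is \<open>y' + p y + q = 0\<close> for \<open>y = r / a\<close> with denominators cleared. At a pole of
  \<open>y\<close>, the derivative would have a pole of higher order than \<open>p y + q\<close>. In lowest terms this says
  that the denominator divides its own derivative, hence is constant.
\<close>
lemma rational_solution_is_polynomial:
  fixes a r p q :: "complex poly"
  assumes "a \<noteq> 0" and eq: "a * pderiv r + p * a * r + a^2 * q = pderiv a * r"
  shows "\<exists>y. r = a * y \<and> pderiv y + p * y + q = 0"
proof -
  define g where "g = gcd r a"
  have g: "g \<noteq> 0" using assms by (simp add: g_def)
  obtain u v where uv: "r = u * g" "a = v * g" "coprime u v"
    using gcd_coprime_exists[of r a] g unfolding g_def by blast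
  have v0: "v \<noteq> 0" using assms uv by auto
  have "g^2 * (v * pderiv u + p * v * u + v^2 * q) = g^2 * (pderiv v * u)"
    using eq unfolding uv by (simp add: pderiv_mult power2_eq_square algebra_simps)
  then have red: "v * pderiv u + p * v * u + v^2 * q = pderiv v * u"
    using g by simp
  have "v dvd pderiv v * u"
    unfolding red[symmetric] power2_eq_square by (simp add: mult.assoc mult.left_commute[of p])
  then have pv: "pderiv v = 0" using uv(3) coprime_dvd_pderiv_imp_const by blast
  then obtain s where s: "v = [:s:]" using pderiv_iszero by blast
  with v0 have s0: "s \<noteq> 0" by simp
  define y where "y = smult (inverse s) u"
  have "u = v * y" using s s0 by (simp add: y_def)
  moreover have "v * (pderiv u + p * u + v * q) = 0"
    using red pv by (simp add: algebra_simps power2_eq_square)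
  then have "pderiv u + p * u + v * q = 0" using v0 by simp
  then have "v * (pderiv y + p * y + q) = 0"
    using pv \<open>u = v * y\<close> by (simp add: algebra_simps pderiv_mult)
  ultimately show ?thesis using v0 uv by (intro exI[of _ y]) (simp add: mult_ac)
qed

text \<open>For \<open>y \<noteq> 0\<close> the term \<open>p y\<close> dominates both \<open>y'\<close> and \<open>q\<close> in degree.\<close>
lemma polynomial_solution_trivial:
  fixes y p q :: "complex poly"
  assumes "p \<noteq> 0" "q = 0 \<or> Polynomial.degree q < Polynomial.degree p" "pderiv y + p * y + q = 0"
  shows "y = 0 \<and> q = 0"
proof (rule ccontr)
  assume "\<not> ?thesis"
  with assms have y: "y \<noteq> 0" by auto
  have eq: "p * y = - pderiv y - q"
  proof -
    have "p * y = (pderiv y + p * y + q) - pderiv y - q" by simp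
    then show ?thesis using assms(3) by simp
  qed
  have d: "Polynomial.degree (p * y) = Polynomial.degree p + Polynomial.degree y"
    using assms y by (simp add: degree_mult_eq)
  show False
  proof (cases "Polynomial.degree p + Polynomial.degree y = 0")
    case True
    then have "pderiv y = 0" by (simp add: pderiv_eq_0_iff)
    with eq assms(2) True have "p * y = 0" by auto
    then show False using assms y by simp
  next
    case False
    have "Polynomial.degree (- pderiv y) < Polynomial.degree p + Polynomial.degree y"
      using False by (simp add: degree_pderiv) arith
    moreover have "Polynomial.degree q < Polynomial.degree p + Polynomial.degree y"
      using False assms(2) by auto
    ultimately have "Polynomial.degree (p * y) < Polynomial.degree p + Polynomial.degree y"
      unfolding eq by (rule degree_diff_less)
    then show False using d by simp
  qed
qed

section \<open>Polynomial relations and their formal derivative\<close>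

text \<open>
  A polynomial in finitely many functions is encoded by its coefficients, which are indexed by
  monomials; a monomial is the multiset of its factors, each function being its own variable.
\<close>
definition monomial_value :: "(complex \<Rightarrow> complex) multiset \<Rightarrow> complex \<Rightarrow> complex" where
  "monomial_value M z = (\<Prod>v\<in>#M. v z)"

definition relation_value :: "((complex \<Rightarrow> complex) multiset \<Rightarrow> complex poly) \<Rightarrow> complex \<Rightarrow> complex" where
  "relation_value c z = (\<Sum>M | c M \<noteq> 0. poly (c M) z * monomial_value M z)"

lemma monomial_value_simps [simp]:
  "monomial_value {#} z = 1" "monomial_value (add_mset v M) z = v z * monomial_value M z"
  by (simp_all add: monomial_value_def)

lemma relation_value_eq:
  assumes "finite S" "{M. c M \<noteq> 0} \<subseteq> S"
  shows "relation_value c z = (\<Sum>M\<in>S. poly (c M) z * monomial_value M z)"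
  unfolding relation_value_def by (rule sum.mono_neutral_left) (use assms in auto)

text \<open>
  The functions in \<open>H\<close> play the role of \<open>F_0, ..., F_(d-2)\<close>. The
  polynomials \<open>q f\<close> abstract from \<open>z^j\<close>: what matters is their independence over the constants
  and the degree bound, under which \<open>y' + p y + Q = 0\<close> has no rational solution for a
  combination \<open>Q \<noteq> 0\<close> of them.
\<close>
locale exponential_integrals =
  fixes G :: "complex \<Rightarrow> complex" and H :: "(complex \<Rightarrow> complex) set"
    and p :: "complex poly" and q :: "(complex \<Rightarrow> complex) \<Rightarrow> complex poly"
  assumes finite_H: "finite H" and G_notin_H: "G \<notin> H"
    and p_nonzero: "p \<noteq> 0"
    and G_nonzero: "G z \<noteq> 0"
    and G_deriv: "(G has_field_derivative poly p z * G z) (at z)"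
    and H_deriv: "f \<in> H \<Longrightarrow> (f has_field_derivative poly (q f) z * G z) (at z)"
    and degree_q: "f \<in> H \<Longrightarrow> Polynomial.degree (q f) < Polynomial.degree p"
    and q_independent: "\<lbrakk>(\<Sum>f\<in>H. smult (s f) (q f)) = 0; f \<in> H\<rbrakk> \<Longrightarrow> s f = 0"
begin

text \<open>
  The derivative of every variable, \<open>G\<close> included, is its slope times \<open>G\<close>. This makes
  differentiation the exchange of one factor of a monomial for \<open>G\<close>.
\<close>
definition slope :: "(complex \<Rightarrow> complex) \<Rightarrow> complex poly" where
  "slope v = (if v = G then p else q v)"

lemma slope_simps: "slope G = p" "f \<in> H \<Longrightarrow> slope f = q f"
  using G_notin_H by (auto simp: slope_def)

abbreviation B where "B \<equiv> insert G H"

lemma B_deriv: "v \<in> B \<Longrightarrow> (v has_field_derivative poly (slope v) z * G z) (at z)"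
  using G_deriv H_deriv by (auto simp: slope_simps)

text \<open>
  The monomial \<open>N\<close> arises from those \<open>M\<close> in which one factor \<open>v\<close> is exchanged for \<open>G\<close>, so
  \<open>M = add_mset v (N - {#G#})\<close>, once for every occurrence of \<open>v\<close> in \<open>M\<close>.
\<close>
definition formal_deriv :: "((complex \<Rightarrow> complex) multiset \<Rightarrow> complex poly) \<Rightarrow> (complex \<Rightarrow> complex) multiset \<Rightarrow> complex poly"
  where "formal_deriv c N = pderiv (c N) +
    (if G \<in># N then \<Sum>v\<in>B. let M = add_mset v (N - {#G#}) in of_nat (count M v) * slope v * c M else 0)"

lemma monomial_value_deriv:
  assumes "set_mset M \<subseteq> B"
  shows "(monomial_value M has_field_derivative
     (\<Sum>v\<in>B. of_nat (count M v) * poly (slope v) z * monomial_value (add_mset G (M - {#v#})) z)) (at z)"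
  using assms
proof (induction M)
  case empty
  have "monomial_value {#} = (\<lambda>_. 1)" by auto
  then show ?case by simp
next
  case (add x M)
  let ?D = "\<lambda>M v. of_nat (count M v) * poly (slope v) z * monomial_value (add_mset G (M - {#v#})) z"
  have x: "x \<in> B" and M: "set_mset M \<subseteq> B" using add.prems by auto
  have eq: "monomial_value (add_mset x M) = (\<lambda>z. x z * monomial_value M z)" by auto
  have "((\<lambda>z. x z * monomial_value M z) has_field_derivative
      x z * (\<Sum>v\<in>B. ?D M v) + poly (slope x) z * G z * monomial_value M z) (at z)"
    by (rule DERIV_mult'[OF B_deriv[OF x] add.IH[OF M]])
  moreover have "?D (add_mset x M) v = x z * ?D M v + (if v = x then poly (slope x) z * G z * monomial_value M z else 0)" for v
  proof (cases "v \<in># M")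
    case True
    then obtain M' where "M = add_mset v M'" by (metis insert_DiffM)
    then show ?thesis by (auto simp: algebra_simps)
  next
    case False
    then show ?thesis by (auto simp: not_in_iff)
  qed
  then have "(\<Sum>v\<in>B. ?D (add_mset x M) v) =
      x z * (\<Sum>v\<in>B. ?D M v) + poly (slope x) z * G z * monomial_value M z"
    using x finite_H by (simp add: sum.distrib sum_distrib_left sum.delta del: sum.insert)
  ultimately show ?case unfolding eq by simp
qed

definition admissible where
  "admissible c \<longleftrightarrow> finite {M. c M \<noteq> (0::complex poly)} \<and> (\<forall>M. c M \<noteq> 0 \<longrightarrow> set_mset M \<subseteq> B)"

lemma formal_deriv_nonzero_cases:
  assumes "formal_deriv c N \<noteq> 0"
  obtains "c N \<noteq> 0" | M v where "c M \<noteq> 0" "v \<in># M" "v \<in> B" "N = add_mset G (M - {#v#})"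
proof (cases "c N = 0")
  case True
  with assms have G: "G \<in># N" and "(\<Sum>v\<in>B. let M = add_mset v (N - {#G#}) in of_nat (count M v) * slope v * c M) \<noteq> 0"
    by (auto simp: formal_deriv_def split: if_splits)
  then obtain v where v: "v \<in> B" "(let M = add_mset v (N - {#G#}) in of_nat (count M v) * slope v * c M) \<noteq> 0"
    by (meson sum.neutral)
  have "c (add_mset v (N - {#G#})) \<noteq> 0" using v(2) by (auto simp only: Let_def mult_zero_right)
  then show ?thesis using G v(1) by (intro that(2)[of "add_mset v (N - {#G#})" v]) auto
qed (use that in auto)

lemma formal_deriv_support:
  "{N. formal_deriv c N \<noteq> 0} \<subseteq> {M. c M \<noteq> 0} \<union> (\<Union>v\<in>B. (\<lambda>M. add_mset G (M - {#v#})) ` {M. c M \<noteq> 0})"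
proof
  fix N assume "N \<in> {N. formal_deriv c N \<noteq> 0}"
  then have "formal_deriv c N \<noteq> 0" by simp
  then show "N \<in> {M. c M \<noteq> 0} \<union> (\<Union>v\<in>B. (\<lambda>M. add_mset G (M - {#v#})) ` {M. c M \<noteq> 0})"
    by (cases rule: formal_deriv_nonzero_cases) blast+
qed

lemma admissible_formal_deriv:
  assumes "admissible c" shows "admissible (formal_deriv c)"
  unfolding admissible_def
proof (intro conjI allI impI)
  show "finite {M. formal_deriv c M \<noteq> 0}"
    by (rule finite_subset[OF formal_deriv_support]) (use assms finite_H in \<open>auto simp: admissible_def\<close>)
  fix N assume "formal_deriv c N \<noteq> 0"
  then show "set_mset N \<subseteq> B"
  proof (cases rule: formal_deriv_nonzero_cases)
    case (2 M v)
    then have "set_mset M \<subseteq> B" using assms by (auto simp: admissible_def)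
    then show ?thesis using 2 by (auto dest: in_diffD)
  qed (use assms in \<open>auto simp: admissible_def\<close>)
qed

text \<open>
  After exchanging sums, both sides agree for each variable \<open>v\<close>, because exchanging a factor
  \<open>v\<close> for \<open>G\<close> is a bijection between the monomials containing \<open>v\<close> and those containing \<open>G\<close>.
\<close>
lemma relation_value_deriv:
  assumes "admissible c"
  shows "(relation_value c has_field_derivative relation_value (formal_deriv c) z) (at z)"
proof -
  define S where "S = {M. c M \<noteq> 0}"
  define T where "T = S \<union> (\<Union>v\<in>B. (\<lambda>M. add_mset G (M - {#v#})) ` S)"
  have fS: "finite S" and SB: "\<And>M. M \<in> S \<Longrightarrow> set_mset M \<subseteq> B"
    using assms by (auto simp: admissible_def S_def)
  have fT: "finite T" using fS finite_H by (auto simp: T_def)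
  let ?t = "\<lambda>v M. of_nat (count M v) * poly (slope v) z * monomial_value (add_mset G (M - {#v#})) z"
  let ?u = "\<lambda>v N. if G \<in># N then of_nat (count (add_mset v (N - {#G#})) v) * poly (slope v) z *
      poly (c (add_mset v (N - {#G#}))) z * monomial_value N z else 0"
  have "((\<lambda>z. \<Sum>M\<in>S. poly (c M) z * monomial_value M z) has_field_derivative
     (\<Sum>M\<in>S. poly (c M) z * (\<Sum>v\<in>B. ?t v M) + poly (pderiv (c M)) z * monomial_value M z)) (at z)"
    by (intro DERIV_sum DERIV_mult' poly_DERIV monomial_value_deriv SB)
  note d1 = this
  have d2: "relation_value c = (\<lambda>z. \<Sum>M\<in>S. poly (c M) z * monomial_value M z)"
    by (auto simp: relation_value_def S_def)
  have shift: "(\<Sum>M\<in>S. poly (c M) z * ?t v M) = (\<Sum>N\<in>T. ?u v N)" if "v \<in> B" for v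
  proof -
    let ?T = "{N\<in>T. G \<in># N \<and> add_mset v (N - {#G#}) \<in> S}"
    have "(\<Sum>M\<in>S. poly (c M) z * ?t v M) = (\<Sum>M | M \<in> S \<and> v \<in># M. poly (c M) z * ?t v M)"
      by (rule sum.mono_neutral_right) (use fS in \<open>auto simp: not_in_iff\<close>)
    also have "\<dots> = (\<Sum>N\<in>?T. ?u v N)"
    proof (rule sum.reindex_bij_witness[where j = "\<lambda>M. add_mset G (M - {#v#})"
            and i = "\<lambda>N. add_mset v (N - {#G#})"])
      fix M assume M: "M \<in> {M. M \<in> S \<and> v \<in># M}"
      then have v: "v \<in># M" by auto
      then show eq: "add_mset v (add_mset G (M - {#v#}) - {#G#}) = M" by simp
      show "add_mset G (M - {#v#}) \<in> ?T"
        using M that eq by (auto simp: T_def)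
      show "?u v (add_mset G (M - {#v#})) = poly (c M) z * ?t v M"
        unfolding eq by (simp add: mult_ac)
    qed auto
    also have "\<dots> = (\<Sum>N\<in>T. ?u v N)"
      by (rule sum.mono_neutral_left) (use fT in \<open>auto simp: S_def\<close>)
    finally show ?thesis .
  qed
  have "(\<Sum>M\<in>S. poly (c M) z * (\<Sum>v\<in>B. ?t v M)) = (\<Sum>v\<in>B. \<Sum>M\<in>S. poly (c M) z * ?t v M)"
    unfolding sum_distrib_left by (rule sum.swap)
  also have "\<dots> = (\<Sum>v\<in>B. \<Sum>N\<in>T. ?u v N)" by (rule sum.cong) (use shift in auto)
  also have "\<dots> = (\<Sum>N\<in>T. \<Sum>v\<in>B. ?u v N)" by (rule sum.swap)
  finally have 1: "(\<Sum>M\<in>S. poly (c M) z * (\<Sum>v\<in>B. ?t v M)) = (\<Sum>N\<in>T. \<Sum>v\<in>B. ?u v N)" .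
  have 2: "(\<Sum>M\<in>S. poly (pderiv (c M)) z * monomial_value M z) = (\<Sum>N\<in>T. poly (pderiv (c N)) z * monomial_value N z)"
    by (rule sum.mono_neutral_left) (use fT in \<open>auto simp: T_def S_def\<close>)
  have "relation_value (formal_deriv c) z = (\<Sum>N\<in>T. poly (formal_deriv c N) z * monomial_value N z)"
    by (rule relation_value_eq[OF fT]) (use formal_deriv_support[of c] in \<open>simp add: T_def S_def\<close>)
  also have "\<dots> = (\<Sum>N\<in>T. (\<Sum>v\<in>B. ?u v N) + poly (pderiv (c N)) z * monomial_value N z)"
  proof (rule sum.cong)
    fix N
    show "poly (formal_deriv c N) z * monomial_value N z = (\<Sum>v\<in>B. ?u v N) + poly (pderiv (c N)) z * monomial_value N z"
      by (cases "G \<in># N")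
         (simp_all add: formal_deriv_def poly_sum sum_distrib_right Let_def distrib_right add.commute
           del: sum.insert count_add_mset)
  qed simp
  also have "\<dots> = (\<Sum>M\<in>S. poly (c M) z * (\<Sum>v\<in>B. ?t v M) + poly (pderiv (c M)) z * monomial_value M z)"
    by (simp only: sum.distrib 1 2)
  finally show ?thesis using d1 unfolding d2 by simp
qed

section \<open>Absence of algebraic relations\<close>

definition integral_degree :: "(complex \<Rightarrow> complex) multiset \<Rightarrow> nat" where
  "integral_degree M = size (filter_mset (\<lambda>v. v \<noteq> G) M)"

lemma formal_deriv_split:
  "formal_deriv c N = pderiv (c N) + of_nat (count N G) * p * c N +
    (if G \<in># N then \<Sum>f\<in>H. of_nat (count (add_mset f (N - {#G#})) f) * q f * c (add_mset f (N - {#G#})) else 0)"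
proof (cases "G \<in># N")
  case True
  have "(\<Sum>v\<in>H. of_nat (count (add_mset v (N - {#G#})) v) * slope v * c (add_mset v (N - {#G#}))) =
    (\<Sum>f\<in>H. of_nat (count (add_mset f (N - {#G#})) f) * q f * c (add_mset f (N - {#G#})))"
    by (rule sum.cong) (simp_all only: slope_simps)
  then show ?thesis
    using True finite_H G_notin_H
    by (simp add: formal_deriv_def Let_def slope_simps(1) add.assoc del: count_add_mset)
next
  case False
  then show ?thesis by (simp add: formal_deriv_def count_eq_zero_iff)
qed

lemma integral_degree_zeroD:
  assumes "integral_degree M = 0"
  shows "M = replicate_mset (count M G) G"
proof -
  have "filter_mset (\<lambda>v. v \<noteq> G) M = {#}" using assms by (simp add: integral_degree_def)
  then show ?thesis
    using multiset_partition[of M "\<lambda>v. v \<noteq> G"]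
    by (metis (mono_tags, lifting) add_0 filter_eq_replicate_mset filter_mset_cong)
qed

lemma integral_degree_shift: "G \<in># N \<Longrightarrow> f \<in> H \<Longrightarrow> integral_degree (add_mset f (N - {#G#})) = Suc (integral_degree N)"
  using G_notin_H by (auto simp: integral_degree_def)

text \<open>
  A monomial of top degree cannot arise by exchanging an integral for \<open>G\<close>, as the original
  monomial would have higher degree.
\<close>
lemma formal_deriv_top:
  assumes "\<And>M. integral_degree M > n \<Longrightarrow> c M = 0" "integral_degree N \<ge> n"
  shows "formal_deriv c N = pderiv (c N) + of_nat (count N G) * p * c N"
proof -
  have "(\<Sum>f\<in>H. of_nat (count (add_mset f (N - {#G#})) f) * q f * c (add_mset f (N - {#G#}))) = 0" if "G \<in># N"
    by (rule sum.neutral) (use assms that integral_degree_shift in auto)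
  then show ?thesis by (simp add: formal_deriv_split)
qed

context
  \<comment> \<open>\<open>c\<close> is a polynomial whose derivative is a multiple of itself over the field of rational
    functions (a Darboux polynomial). The multiplier is dictated by a top monomial \<open>M0\<close>.\<close>
  fixes c n M0
  assumes c: "admissible c" and bound: "\<And>M. integral_degree M > n \<Longrightarrow> c M = 0"
    and M0: "c M0 \<noteq> 0" "integral_degree M0 = n"
    and darboux: "\<And>M. c M0 * formal_deriv c M = (pderiv (c M0) + of_nat (count M0 G) * p * c M0) * c M"
begin

text \<open>
  Over the rational functions the quotient of a top coefficient by \<open>c M0\<close> satisfies a homogeneous
  first-order equation, so this quotient is a polynomial.
\<close>
lemma darboux_top:
  assumes "integral_degree M = n"
  obtains y where "c M = c M0 * y"
    "pderiv y + (of_nat (count M G) - of_nat (count M0 G)) * p * y = 0"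
proof -
  have "c M0 * (pderiv (c M) + of_nat (count M G) * p * c M) =
      (pderiv (c M0) + of_nat (count M0 G) * p * c M0) * c M"
    using darboux[of M] formal_deriv_top[of n c M] bound assms by simp
  then have "c M0 * pderiv (c M) + ((of_nat (count M G) - of_nat (count M0 G)) * p) * c M0 * c M
      + (c M0)^2 * 0 = pderiv (c M0) * c M"
    by (simp add: algebra_simps)
  from rational_solution_is_polynomial[OF M0(1) this] that show ?thesis by auto
qed

lemma darboux_top_zero:
  assumes "integral_degree M = n" "count M G \<noteq> count M0 G"
  shows "c M = 0"
proof -
  obtain y where y: "c M = c M0 * y" "pderiv y + (of_nat (count M G) - of_nat (count M0 G)) * p * y = 0"
    using darboux_top assms(1) by blast
  have "(of_nat (count M G) - of_nat (count M0 G)) * p \<noteq> 0"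
    using assms(2) p_nonzero by simp
  from polynomial_solution_trivial[OF this, of 0 y] y(2) have "y = 0" by force
  then show ?thesis using y(1) by simp
qed

lemma darboux_top_constant:
  assumes "integral_degree M = n" "count M G = count M0 G"
  shows "\<exists>s. c M = smult s (c M0)"
proof -
  obtain y where y: "c M = c M0 * y" "pderiv y = 0"
    using darboux_top assms by (metis diff_self mult_zero_left add.right_neutral)
  then obtain s where "y = [:s:]" using pderiv_iszero by blast
  then show ?thesis using y by auto
qed

text \<open>
  Take a factor \<open>f0\<close> of \<open>M0\<close> that is an integral and exchange it for \<open>G\<close>. At the resulting
  monomial, of degree \<open>n - 1\<close>, the derivative receives contributions from the monomials of degree
  \<open>n\<close>, whose coefficients are constant multiples of \<open>c M0\<close>. They add up to the inhomogeneity \<open>Q\<close>.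
\<close>
lemma darboux_degree_zero: "n = 0"
proof (rule ccontr)
  assume "n \<noteq> 0"
  with M0(2) have "filter_mset (\<lambda>v. v \<noteq> G) M0 \<noteq> {#}" by (metis size_empty integral_degree_def)
  then obtain f0 where f0: "f0 \<in># M0" "f0 \<noteq> G"
    unfolding filter_mset_eq_mempty_iff by blast
  have f0H: "f0 \<in> H" using c M0(1) f0 by (auto simp: admissible_def)
  define K where "K = M0 - {#f0#}"
  have K: "M0 = add_mset f0 K" using f0 by (simp add: K_def)
  have GH: "f \<noteq> G" if "f \<in> H" for f using that G_notin_H by auto
  have deg: "integral_degree (add_mset f K) = n" "count (add_mset f K) G = count M0 G" if "f \<in> H" for f
    using GH[OF that] M0(2) f0(2) by (auto simp: integral_degree_def K)
  obtain s where s: "\<And>f. f \<in> H \<Longrightarrow> c (add_mset f K) = smult (s f) (c M0)"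
    using bchoice[of H "\<lambda>f s. c (add_mset f K) = smult s (c M0)"] darboux_top_constant deg by blast
  define Q where "Q = (\<Sum>f\<in>H. smult (of_nat (count (add_mset f K) f) * s f) (q f))"
  define a u where "a = c M0" and "u = c (add_mset G K)"
  have "(\<Sum>f\<in>H. of_nat (count (add_mset f K) f) * q f * c (add_mset f K)) = a * Q"
    unfolding Q_def sum_distrib_left
    by (rule sum.cong) (simp_all add: s a_def of_nat_poly mult_ac del: count_add_mset)
  then have "formal_deriv c (add_mset G K) = pderiv u + of_nat (count M0 G + 1) * p * u + a * Q"
    using f0(2) by (simp add: formal_deriv_split u_def K del: count_add_mset) (simp add: add.commute)
  with darboux[of "add_mset G K"]
  have "a * (pderiv u + of_nat (count M0 G + 1) * p * u + a * Q) = (pderiv a + of_nat (count M0 G) * p * a) * u"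
    by (simp add: a_def u_def)
  then have "a * pderiv u + p * a * u + a^2 * Q = pderiv a * u"
    by (simp add: algebra_simps power2_eq_square)
  then obtain y where y: "pderiv y + p * y + Q = 0"
    using rational_solution_is_polynomial[of a u p Q] M0(1) by (auto simp: a_def)
  have "Polynomial.degree Q < Polynomial.degree p"
    unfolding Q_def
  proof (rule degree_sum_less)
    show "0 < Polynomial.degree p" using degree_q[OF f0H] by simp
    fix f assume "f \<in> H"
    then show "Polynomial.degree (smult (of_nat (count (add_mset f K) f) * s f) (q f)) < Polynomial.degree p"
      using degree_q degree_smult_le le_less_trans by blast
  qed
  then have "Q = 0" using polynomial_solution_trivial[OF p_nonzero _ y] by simp
  then have "of_nat (count (add_mset f0 K) f0) * s f0 = 0"
    using q_independent[of "\<lambda>f. of_nat (count (add_mset f K) f) * s f"] f0H unfolding Q_def by blast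
  \<comment> \<open>This contradicts \<open>s f0 = 1\<close>, which holds since \<open>add_mset f0 K\<close> is \<open>M0\<close> itself.\<close>
  then have "s f0 = 0" by (simp only: mult_eq_0_iff of_nat_eq_0_iff) simp
  then show False using s[OF f0H] M0(1) K by simp
qed

end

text \<open>
  Induction on the degree \<open>n\<close> in the integrals, and within it on the number of monomials of
  degree \<open>n\<close>. The relation \<open>c'\<close> in the proof has lost the monomial \<open>M0\<close> and gained no other of
  degree \<open>n\<close>, so by induction it is formally zero, which makes \<open>c\<close> a Darboux polynomial.
\<close>
proposition no_algebraic_relation:
  assumes "admissible c" "\<And>z. relation_value c z = 0"
  shows "c M = 0"
proof -
  have "\<forall>M. c M = 0" if "admissible c" "\<And>z. relation_value c z = 0" "\<And>M. integral_degree M > n \<Longrightarrow> c M = 0" for n c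
    using that
  proof (induction n arbitrary: c rule: less_induct)
    case (less n)
    note lower_degree = less.IH
    show ?case using less.prems
    proof (induction "card {M. c M \<noteq> 0 \<and> integral_degree M = n}" arbitrary: c rule: less_induct)
      case (less c)
      note c = \<open>admissible c\<close> and zero = \<open>\<And>z. relation_value c z = 0\<close> and bound = \<open>\<And>M. n < integral_degree M \<Longrightarrow> c M = 0\<close>
      have fin: "finite {M. c M \<noteq> 0}" using c by (simp add: admissible_def)
      show ?case
      proof (rule ccontr)
        assume nz: "\<not> ?case"
        have "\<exists>M. c M \<noteq> 0 \<and> integral_degree M = n"
        proof (rule ccontr)
          assume none: "\<not> ?thesis"
          show False
          proof (cases n)
            case 0
            with none bound nz show False by (metis gr0I)
          next
            case (Suc m)
            have "c M = 0" if "m < integral_degree M" for M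
              using that none bound[of M] Suc by (metis Suc_lessI)
            then show False using lower_degree[OF _ c zero, of m] nz Suc by blast
          qed
        qed
        then obtain M0 where M0: "c M0 \<noteq> 0" "integral_degree M0 = n" by blast
        define b where "b = pderiv (c M0) + of_nat (count M0 G) * p * c M0"
        define c' where "c' M = c M0 * formal_deriv c M - b * c M" for M
        have adD: "admissible (formal_deriv c)" by (rule admissible_formal_deriv[OF c])
        have sub: "{M. c' M \<noteq> 0} \<subseteq> {M. formal_deriv c M \<noteq> 0} \<union> {M. c M \<noteq> 0}" by (auto simp: c'_def)
        have fin': "finite ({M. formal_deriv c M \<noteq> 0} \<union> {M. c M \<noteq> 0})"
          using c adD by (simp add: admissible_def)
        have ad': "admissible c'"
          unfolding admissible_def
        proof (intro conjI allI impI)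
          show "finite {M. c' M \<noteq> 0}" by (rule finite_subset[OF sub fin'])
          fix M assume "c' M \<noteq> 0"
          then have "formal_deriv c M \<noteq> 0 \<or> c M \<noteq> 0" using sub by auto
          then show "set_mset M \<subseteq> B" using c adD by (auto simp: admissible_def)
        qed
        have deriv0: "relation_value (formal_deriv c) z = 0" for z
        proof -
          have "relation_value c = (\<lambda>_. 0)" using zero by auto
          with relation_value_deriv[OF c, of z] show ?thesis
            by (metis DERIV_const DERIV_unique)
        qed
        have zero': "relation_value c' z = 0" for z
        proof -
          have "relation_value c' z = poly (c M0) z * relation_value (formal_deriv c) z - poly b z * relation_value c z"
            unfolding relation_value_eq[OF fin' sub] relation_value_eq[OF fin' Un_upper1] relation_value_eq[OF fin' Un_upper2]
            by (simp add: c'_def sum_distrib_left sum_subtractf algebra_simps)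
          then show ?thesis using deriv0 zero by simp
        qed
        have top': "c' M = c M0 * (pderiv (c M) + of_nat (count M G) * p * c M) - b * c M" if "n \<le> integral_degree M" for M
          using formal_deriv_top[of n c M] bound that by (simp add: c'_def)
        have bound': "c' M = 0" if "n < integral_degree M" for M
          using top'[of M] bound[OF that] that by simp
        have "{M. c' M \<noteq> 0 \<and> integral_degree M = n} \<subset> {M. c M \<noteq> 0 \<and> integral_degree M = n}"
        proof
          show "{M. c' M \<noteq> 0 \<and> integral_degree M = n} \<subseteq> {M. c M \<noteq> 0 \<and> integral_degree M = n}"
            using top' by auto
          have "c' M0 = 0" using top'[of M0] M0(2) by (simp add: b_def algebra_simps)
          then show "{M. c' M \<noteq> 0 \<and> integral_degree M = n} \<noteq> {M. c M \<noteq> 0 \<and> integral_degree M = n}"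
            using M0 by blast
        qed
        then have "card {M. c' M \<noteq> 0 \<and> integral_degree M = n} < card {M. c M \<noteq> 0 \<and> integral_degree M = n}"
          by (rule psubset_card_mono[rotated]) (use fin in simp)
        from less.hyps[OF this ad' zero' bound'] have "c' M = 0" for M by simp
        then have darboux: "c M0 * formal_deriv c M = (pderiv (c M0) + of_nat (count M0 G) * p * c M0) * c M" for M
          by (simp add: c'_def b_def)
        have n0: "n = 0" by (rule darboux_degree_zero[OF c bound M0 darboux])
        \<comment> \<open>In degree zero a monomial is a power of \<open>G\<close>, and only the exponent of \<open>M0\<close> survives.\<close>
        have single: "M = M0" if "c M \<noteq> 0" for M
        proof -
          have "integral_degree M = 0" using bound[of M] that n0 by auto
          moreover have "count M G = count M0 G"
            using darboux_top_zero[OF c bound M0 darboux, of M] that \<open>integral_degree M = 0\<close> n0 by auto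
          ultimately show ?thesis
            using integral_degree_zeroD[of M] integral_degree_zeroD[of M0] M0(2) n0 by simp
        qed
        then have "{M. c M \<noteq> 0} = {M0}" using M0(1) by blast
        then have val: "poly (c M0) z * monomial_value M0 z = 0" for z
          using zero[of z] by (simp add: relation_value_def)
        have "set_mset M0 \<subseteq> {G}"
          using M0(2) n0 by (auto simp: integral_degree_def)
        then have "monomial_value M0 z \<noteq> 0" for z
          unfolding monomial_value_def using G_nonzero by (auto simp: prod_mset_zero_iff)
        with val have "\<forall>z. poly (c M0) z = 0" by (meson mult_eq_0_iff)
        then have "c M0 = 0" by (simp only: poly_all_0_iff_0)
        with M0 show False by simp
      qed
    qed
  qed
  note bounded = this
  have "c M = 0" if "integral_degree M > (\<Sum>M | c M \<noteq> 0. integral_degree M)" for M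
  proof (rule ccontr)
    assume "c M \<noteq> 0"
    then have "integral_degree M \<le> (\<Sum>M | c M \<noteq> 0. integral_degree M)"
      using assms(1) member_le_sum[of M "{M. c M \<noteq> 0}" integral_degree] by (simp add: admissible_def)
    with that show False by simp
  qed
  from bounded[OF assms this] show ?thesis by simp
qed

end

section \<open>Generated fields and indexed polynomials\<close>

lemma (in field) generate_field_fractions:
  assumes A: "subring A R" and H: "\<And>h. h \<in> H \<Longrightarrow> \<exists>a\<in>A. \<exists>b\<in>A - {\<zero>}. h = a \<otimes> inv b"
  shows "x \<in> generate_field R H \<Longrightarrow> \<exists>a\<in>A. \<exists>b\<in>A - {\<zero>}. x = a \<otimes> inv b"
proof (induction rule: generate_field.induct)
  note cl = subringE[OF A]
  have car: "a \<in> carrier R" if "a \<in> A" for a using that cl(1) by blast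
  have unit: "inv b \<in> carrier R" "b \<otimes> inv b = \<one>" "inv b \<noteq> \<zero>" if "b \<in> A - {\<zero>}" for b
  proof -
    have "b \<in> Units R" using that car field_Units by auto
    then show "inv b \<in> carrier R" "b \<otimes> inv b = \<one>" by auto
    then show "inv b \<noteq> \<zero>" using that car by auto
  qed
  have mult: "b \<otimes> e \<in> A - {\<zero>}" "inv (b \<otimes> e) = inv b \<otimes> inv e"
    if b: "b \<in> A - {\<zero>}" and e: "e \<in> A - {\<zero>}" for b e
  proof -
    have "b \<otimes> e \<noteq> \<zero>" using b e car integral[of b e] by auto
    then show "b \<otimes> e \<in> A - {\<zero>}" using b e cl(6) by simp
    show "inv (b \<otimes> e) = inv b \<otimes> inv e"
    proof (rule comm_inv_char)
      have "b \<otimes> e \<otimes> (inv b \<otimes> inv e) = (b \<otimes> inv b) \<otimes> (e \<otimes> inv e)"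
        using b e car unit(1) by (simp add: m_ac)
      then show "b \<otimes> e \<otimes> (inv b \<otimes> inv e) = \<one>" using b e unit(2) by simp
    qed (use b e car unit(1) in auto)
  qed
  {
    case one
    show ?case by (intro bexI[of _ \<one>]) (use cl in auto)
  next
    case (incl h)
    then show ?case by (rule H)
  next
    case (a_inv h)
    then obtain a b where "a \<in> A" "b \<in> A - {\<zero>}" "h = a \<otimes> inv b" by blast
    then have "\<ominus> h = (\<ominus> a) \<otimes> inv b" using car unit(1) by (simp add: l_minus)
    then show ?case using \<open>a \<in> A\<close> \<open>b \<in> A - {\<zero>}\<close> cl(5) by blast
  next
    case (m_inv h)
    then obtain a b where ab: "a \<in> A" "b \<in> A - {\<zero>}" "h = a \<otimes> inv b" by blast
    then have a: "a \<in> A - {\<zero>}" using m_inv unit(1) by auto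
    have "h \<otimes> (b \<otimes> inv a) = (a \<otimes> inv a) \<otimes> (b \<otimes> inv b)"
      using ab a car unit(1) by (simp add: m_ac)
    then have "h \<otimes> (b \<otimes> inv a) = \<one>" using ab a unit by simp
    then have "inv h = b \<otimes> inv a"
      using ab a car unit(1) by (intro comm_inv_char) auto
    then show ?case using ab a by blast
  next
    case (eng_add h1 h2)
    then obtain a b c e where ab: "a \<in> A" "b \<in> A - {\<zero>}" "h1 = a \<otimes> inv b"
      and ce: "c \<in> A" "e \<in> A - {\<zero>}" "h2 = c \<otimes> inv e" by blast
    note be = mult[OF ab(2) ce(2)]
    have x: "inv b \<in> carrier R" "inv e \<in> carrier R" "a \<in> carrier R" "b \<in> carrier R" "c \<in> carrier R" "e \<in> carrier R"
      using ab ce car unit(1) by auto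
    have "(a \<otimes> e \<oplus> c \<otimes> b) \<otimes> inv (b \<otimes> e) = a \<otimes> e \<otimes> (inv b \<otimes> inv e) \<oplus> c \<otimes> b \<otimes> (inv b \<otimes> inv e)"
      unfolding be(2) using x by (simp add: l_distr)
    also have "a \<otimes> e \<otimes> (inv b \<otimes> inv e) = a \<otimes> inv b \<otimes> (e \<otimes> inv e)" using x by (simp add: m_ac)
    also have "\<dots> = h1" using ab(3) ce(2) unit(2) x by simp
    also have "c \<otimes> b \<otimes> (inv b \<otimes> inv e) = c \<otimes> inv e \<otimes> (b \<otimes> inv b)" using x by (simp add: m_ac)
    also have "\<dots> = h2" using ce(3) ab(2) unit(2) x by simp
    finally have eq: "h1 \<oplus> h2 = (a \<otimes> e \<oplus> c \<otimes> b) \<otimes> inv (b \<otimes> e)" by (rule sym)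
    have "a \<otimes> e \<oplus> c \<otimes> b \<in> A" using ab ce by (simp add: cl(6,7))
    with eq show ?case using be(1) by (intro bexI)
  next
    case (eng_mult h1 h2)
    then obtain a b c e where ab: "a \<in> A" "b \<in> A - {\<zero>}" "h1 = a \<otimes> inv b"
      and ce: "c \<in> A" "e \<in> A - {\<zero>}" "h2 = c \<otimes> inv e" by blast
    note be = mult[OF ab(2) ce(2)]
    have x: "inv b \<in> carrier R" "inv e \<in> carrier R" "a \<in> carrier R" "c \<in> carrier R"
      using ab ce car unit(1) by auto
    have eq: "h1 \<otimes> h2 = (a \<otimes> c) \<otimes> inv (b \<otimes> e)"
      unfolding be(2) ab(3) ce(3) using x by (simp add: m_ac)
    have "a \<otimes> c \<in> A" using ab ce by (simp add: cl(6))
    with eq show ?case using be(1) by (intro bexI)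
  }
qed

lemma (in ring) indexed_pset_coeff:
  assumes K: "subring K R" and P: "P \<in> indexed_pset I K"
  shows "(\<forall>m. P m \<in> K) \<and> finite {m. P m \<noteq> \<zero>} \<and> (\<forall>m. P m \<noteq> \<zero> \<longrightarrow> set_mset m \<subseteq> I)"
  using P
proof induction
  case (indexed_const k)
  have "{m. (indexed_const k :: 'c multiset \<Rightarrow> 'a) m \<noteq> \<zero>} \<subseteq> {{#}}"
    by (auto simp: indexed_const_def)
  with indexed_const show ?case
    using subringE(2)[OF K] by (auto simp: indexed_const_def intro: finite_subset)
next
  case (indexed_padd P Q)
  have sub: "{m. (P \<Oplus> Q) m \<noteq> \<zero>} \<subseteq> {m. P m \<noteq> \<zero>} \<union> {m. Q m \<noteq> \<zero>}"
    using K subringE(1) by (auto simp: indexed_padd_def)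
  have "finite {m. (P \<Oplus> Q) m \<noteq> \<zero>}" by (rule finite_subset[OF sub]) (use indexed_padd in auto)
  moreover have "(P \<Oplus> Q) m \<in> K" for m
    using indexed_padd.IH subringE(7)[OF K] by (auto simp: indexed_padd_def)
  moreover have "set_mset m \<subseteq> I" if "(P \<Oplus> Q) m \<noteq> \<zero>" for m
    using sub that indexed_padd.IH by blast
  ultimately show ?case by blast
next
  case (indexed_pmult P i)
  have sub: "{m. (P \<Otimes> i) m \<noteq> \<zero>} \<subseteq> add_mset i ` {m. P m \<noteq> \<zero>}"
  proof
    fix m assume "m \<in> {m. (P \<Otimes> i) m \<noteq> \<zero>}"
    then have "i \<in># m" "P (m - {#i#}) \<noteq> \<zero>" by (auto simp: indexed_pmult_def split: if_splits)
    then show "m \<in> add_mset i ` {m. P m \<noteq> \<zero>}" by (intro image_eqI[of _ _ "m - {#i#}"]) auto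
  qed
  have "finite {m. (P \<Otimes> i) m \<noteq> \<zero>}" by (rule finite_subset[OF sub]) (use indexed_pmult in auto)
  moreover have "(P \<Otimes> i) m \<in> K" for m
    using indexed_pmult.IH subringE(2)[OF K] by (auto simp: indexed_pmult_def)
  moreover have "set_mset m \<subseteq> I" if "(P \<Otimes> i) m \<noteq> \<zero>" for m
    using sub that indexed_pmult by fastforce
  ultimately show ?case by blast
qed

section \<open>Arithmetic of meromorphic functions\<close>

interpretation mero: cring mero
  using field_mero by (simp add: field_def domain_def)

text \<open>
  On entire functions the operations of the field are the pointwise ones; on meromorphic
  functions they agree with the pointwise ones near every point, except possibly at that point.
\<close>
lemma entire_remove_sings: "f holomorphic_on UNIV \<Longrightarrow> remove_sings f = f"
  by (intro ext remove_sings_at_analytic) (simp add: analytic_on_open analytic_on_subset[of f UNIV])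

lemma entire_in_mero: "f holomorphic_on UNIV \<Longrightarrow> f \<in> carrier mero"
  by (simp add: mero_simps analytic_on_imp_nicely_meromorphic_on analytic_on_open)

lemma entire_mult: "f holomorphic_on UNIV \<Longrightarrow> g holomorphic_on UNIV \<Longrightarrow> f \<otimes>\<^bsub>mero\<^esub> g = (\<lambda>z. f z * g z)"
  by (simp add: mero_simps entire_remove_sings holomorphic_on_mult)

lemma entire_add: "f holomorphic_on UNIV \<Longrightarrow> g holomorphic_on UNIV \<Longrightarrow> f \<oplus>\<^bsub>mero\<^esub> g = (\<lambda>z. f z + g z)"
  by (simp add: mero_simps entire_remove_sings holomorphic_on_add)

lemma entire_pow:
  assumes "f holomorphic_on UNIV" shows "f [^]\<^bsub>mero\<^esub> (n::nat) = (\<lambda>z. f z ^ n)"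
proof (induction n)
  case (Suc n)
  have "(\<lambda>z. f z ^ n) holomorphic_on UNIV" using assms by (intro holomorphic_intros)
  then show ?case using Suc assms by (simp add: entire_mult mult.commute)
qed (simp add: mero_simps)

lemma entire_finprod:
  assumes "finite A" "\<And>a. a \<in> A \<Longrightarrow> f a holomorphic_on UNIV"
  shows "finprod mero f A = (\<lambda>z. \<Prod>a\<in>A. f a z)"
  using assms
proof (induction A)
  case (insert a A)
  have "(\<lambda>z. \<Prod>a\<in>A. f a z) holomorphic_on UNIV" using insert by (intro holomorphic_intros) auto
  then show ?case using insert by (simp add: entire_mult entire_in_mero)
qed (simp add: mero_simps)

lemma mero_add_eventually:
  assumes "f \<in> carrier mero" "g \<in> carrier mero"
  shows "\<forall>\<^sub>F w in at z. (f \<oplus>\<^bsub>mero\<^esub> g) w = f w + g w"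
  unfolding mero_simps
  by (rule eventually_remove_sings_meromorphic)
     (use assms in \<open>auto simp: mero_simps intro!: meromorphic_on_add meromorphic_on_mult dest: nicely_imp_meromorphic\<close>)

lemma mero_mult_eventually:
  assumes "f \<in> carrier mero" "g \<in> carrier mero"
  shows "\<forall>\<^sub>F w in at z. (f \<otimes>\<^bsub>mero\<^esub> g) w = f w * g w"
  unfolding mero_simps
  by (rule eventually_remove_sings_meromorphic)
     (use assms in \<open>auto simp: mero_simps intro!: meromorphic_on_add meromorphic_on_mult dest: nicely_imp_meromorphic\<close>)

lemma mero_finsum_eventually:
  assumes "finite A" "\<And>a. a \<in> A \<Longrightarrow> f a \<in> carrier mero"
  shows "\<forall>\<^sub>F w in at z. finsum mero f A w = (\<Sum>a\<in>A. f a w)"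
  using assms
proof (induction A)
  case (insert a A)
  have "finsum mero f (insert a A) = f a \<oplus>\<^bsub>mero\<^esub> finsum mero f A"
    using insert by (intro mero.finsum_insert) auto
  moreover have 1: "\<forall>\<^sub>F w in at z. (f a \<oplus>\<^bsub>mero\<^esub> finsum mero f A) w = f a w + finsum mero f A w"
    using insert by (intro mero_add_eventually mero.finsum_closed) auto
  moreover have 2: "\<forall>\<^sub>F w in at z. finsum mero f A w = (\<Sum>a\<in>A. f a w)" using insert by auto
  have "\<forall>\<^sub>F w in at z. (f a \<oplus>\<^bsub>mero\<^esub> finsum mero f A) w = f a w + (\<Sum>a\<in>A. f a w)"
    using 1 2 by eventually_elim simp
  ultimately show ?case using insert(1,2) by simp
qed (simp add: mero_simps)

lemma entire_monomial:
  assumes "\<And>v. v \<in># M \<Longrightarrow> v holomorphic_on UNIV"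
  shows "finprod mero (\<lambda>b. b [^]\<^bsub>mero\<^esub> count M b) (set_mset M) = monomial_value M" "monomial_value M holomorphic_on UNIV"
proof -
  have eq: "monomial_value M = (\<lambda>z. \<Prod>b\<in>set_mset M. b z ^ count M b)"
    by (simp add: fun_eq_iff monomial_value_def image_prod_mset_multiplicity)
  show "monomial_value M holomorphic_on UNIV" unfolding eq using assms by (intro holomorphic_intros)
  have "finprod mero (\<lambda>b. b [^]\<^bsub>mero\<^esub> count M b) (set_mset M) = finprod mero (\<lambda>b z. b z ^ count M b) (set_mset M)"
    by (rule mero.finprod_cong') (use assms in \<open>auto simp: entire_pow intro!: entire_in_mero holomorphic_intros\<close>)
  also have "\<dots> = monomial_value M"
    unfolding eq by (rule entire_finprod) (use assms in \<open>auto intro!: holomorphic_intros\<close>)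
  finally show "finprod mero (\<lambda>b. b [^]\<^bsub>mero\<^esub> count M b) (set_mset M) = monomial_value M" .
qed

section \<open>The field of rational functions\<close>

lemma poly_eventually_nonzero:
  assumes "q \<noteq> 0" shows "\<forall>\<^sub>F w in at (z::complex). poly q w \<noteq> 0"
proof -
  have "finite {w. poly q w = 0}" using assms by (simp add: poly_roots_finite)
  then have "closed ({w. poly q w = 0} - {z})" by (simp add: finite_imp_closed)
  then have "open (- ({w. poly q w = 0} - {z}))" by (rule open_Compl)
  then show ?thesis unfolding eventually_at_topological by (intro exI[of _ "- ({w. poly q w = 0} - {z})"]) auto
qed

lemma inv_poly_mero:
  assumes "q \<noteq> 0"
  shows "inv\<^bsub>mero\<^esub> (poly q) = (\<lambda>z. inverse (poly q z))"
proof (rule mero.comm_inv_char)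
  have q: "poly q nicely_meromorphic_on UNIV"
    by (intro analytic_on_imp_nicely_meromorphic_on) (simp add: analytic_on_open holomorphic_intros)
  then show "poly q \<in> carrier mero" "(\<lambda>z. inverse (poly q z)) \<in> carrier mero"
    by (auto simp: mero_simps intro: nicely_meromorphic_on_inverse)
  have "remove_sings (\<lambda>z. poly q z * inverse (poly q z)) = remove_sings (\<lambda>_. 1)"
    by (rule remove_sings_eqI_at, rule eventually_mono, rule poly_eventually_nonzero[OF assms]) auto
  then show "poly q \<otimes>\<^bsub>mero\<^esub> (\<lambda>z. inverse (poly q z)) = \<one>\<^bsub>mero\<^esub>"
    by (simp add: mero_simps entire_remove_sings)
qed

lemma rational_functions_eq:
  "rational_functions = {a \<otimes>\<^bsub>mero\<^esub> inv\<^bsub>mero\<^esub> b | a b. a \<in> polynomial_functions \<and> b \<in> polynomial_functions - {\<zero>\<^bsub>mero\<^esub>}}"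
proof -
  have *: "poly p \<otimes>\<^bsub>mero\<^esub> inv\<^bsub>mero\<^esub> (poly q) = remove_sings (\<lambda>z. poly p z / poly q z)" if "q \<noteq> 0" for p q
    using that by (simp add: inv_poly_mero mero_simps divide_inverse)
  have **: "poly q \<noteq> \<zero>\<^bsub>mero\<^esub> \<longleftrightarrow> q \<noteq> 0" for q
    using poly_all_0_iff_0[of q] by (auto simp: mero_simps fun_eq_iff)
  show ?thesis
  proof (intro subset_antisym subsetI)
    fix f assume "f \<in> rational_functions"
    then obtain p q where f: "f = remove_sings (\<lambda>z. poly p z / poly q z)" and q: "q \<noteq> 0"
      by (auto simp: rational_functions_def)
    have "poly p \<in> polynomial_functions" "poly q \<in> polynomial_functions - {\<zero>\<^bsub>mero\<^esub>}"
      using q **[of q] by (simp_all add: polynomial_functions_def)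
    moreover have "f = poly p \<otimes>\<^bsub>mero\<^esub> inv\<^bsub>mero\<^esub> (poly q)" using f *[OF q, of p] by simp
    ultimately show "f \<in> {a \<otimes>\<^bsub>mero\<^esub> inv\<^bsub>mero\<^esub> b | a b. a \<in> polynomial_functions \<and> b \<in> polynomial_functions - {\<zero>\<^bsub>mero\<^esub>}}"
      by blast
  next
    fix f assume "f \<in> {a \<otimes>\<^bsub>mero\<^esub> inv\<^bsub>mero\<^esub> b | a b. a \<in> polynomial_functions \<and> b \<in> polynomial_functions - {\<zero>\<^bsub>mero\<^esub>}}"
    then obtain p q where f: "f = poly p \<otimes>\<^bsub>mero\<^esub> inv\<^bsub>mero\<^esub> (poly q)" and "poly q \<noteq> \<zero>\<^bsub>mero\<^esub>"
      by (auto simp: polynomial_functions_def)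
    then have "q \<noteq> 0" using **[of q] by simp
    with f *[of q p] show "f \<in> rational_functions"
      unfolding rational_functions_def by (intro CollectI exI[of _ p] exI[of _ q]) simp
  qed
qed

lemma polynomial_functions_subring: "subring polynomial_functions mero"
proof (rule mero.subringI)
  have hol: "poly p holomorphic_on UNIV" for p :: "complex poly" by (intro holomorphic_intros)
  show "polynomial_functions \<subseteq> carrier mero"
    using hol by (auto simp: polynomial_functions_def intro: entire_in_mero)
  show "\<one>\<^bsub>mero\<^esub> \<in> polynomial_functions"
    unfolding polynomial_functions_def mero_simps by (intro range_eqI[of _ _ 1]) auto
  fix f assume "f \<in> polynomial_functions"
  then obtain p where p: "f = poly p" by (auto simp: polynomial_functions_def)
  have "poly (-p) \<oplus>\<^bsub>mero\<^esub> f = \<zero>\<^bsub>mero\<^esub>"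
    unfolding p entire_add[OF hol hol] by (simp add: mero_simps)
  then have "\<ominus>\<^bsub>mero\<^esub> f = poly (-p)"
    using p hol entire_in_mero by (intro mero.minus_equality) auto
  then show "\<ominus>\<^bsub>mero\<^esub> f \<in> polynomial_functions" by (auto simp: polynomial_functions_def)
  fix g assume "g \<in> polynomial_functions"
  then obtain q where q: "g = poly q" by (auto simp: polynomial_functions_def)
  show "f \<otimes>\<^bsub>mero\<^esub> g \<in> polynomial_functions"
    unfolding p q entire_mult[OF hol hol] polynomial_functions_def by (intro range_eqI[of _ _ "p * q"]) auto
  show "f \<oplus>\<^bsub>mero\<^esub> g \<in> polynomial_functions"
    unfolding p q entire_add[OF hol hol] polynomial_functions_def by (intro range_eqI[of _ _ "p + q"]) auto
qed

lemma polynomial_functions_closed: "polynomial_functions \<subseteq> carrier mero"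
  using subringE(1)[OF polynomial_functions_subring] .

lemma rational_functions_generated: "rational_functions = generate_field mero polynomial_functions"
proof
  let ?E = "generate_field mero polynomial_functions"
  show "rational_functions \<subseteq> ?E"
    unfolding rational_functions_eq
    by (auto intro: generate_field.eng_mult[OF generate_field.incl generate_field.m_inv] generate_field.incl)
  have one: "\<one>\<^bsub>mero\<^esub> \<in> polynomial_functions" using subringE(3)[OF polynomial_functions_subring] .
  have "\<exists>a\<in>polynomial_functions. \<exists>b\<in>polynomial_functions - {\<zero>\<^bsub>mero\<^esub>}. h = a \<otimes>\<^bsub>mero\<^esub> inv\<^bsub>mero\<^esub> b"
    if "h \<in> polynomial_functions" for h
  proof (rule bexI[of _ h], rule bexI[of _ "\<one>\<^bsub>mero\<^esub>"])
    show "\<one>\<^bsub>mero\<^esub> \<in> polynomial_functions - {\<zero>\<^bsub>mero\<^esub>}"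
      using one by (simp add: mero_simps fun_eq_iff)
    show "h = h \<otimes>\<^bsub>mero\<^esub> inv\<^bsub>mero\<^esub> \<one>\<^bsub>mero\<^esub>" using that polynomial_functions_closed by auto
  qed (rule that)
  then show "?E \<subseteq> rational_functions"
    using field.generate_field_fractions[OF field_mero polynomial_functions_subring, of polynomial_functions]
    unfolding rational_functions_eq by blast
qed

lemma rational_functions_subfield: "subfield rational_functions mero"
  unfolding rational_functions_generated
  by (rule field.generate_field_is_subfield[OF field_mero polynomial_functions_closed])

section \<open>From relations in the field to pointwise relations\<close>

text \<open>
  A relation with rational coefficients, multiplied by the product of all denominators, becomes
  one with polynomial coefficients. It holds near every point with that point possibly excepted,
  and then by continuity at the point as well.
\<close>
lemma algebraically_independentI:
  assumes hol: "\<And>v. v \<in> V \<Longrightarrow> v holomorphic_on UNIV"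
    and ind: "\<And>c M. finite {M. c M \<noteq> 0} \<Longrightarrow> (\<And>M. c M \<noteq> 0 \<Longrightarrow> set_mset M \<subseteq> V) \<Longrightarrow>
       (\<And>z. relation_value c z = 0) \<Longrightarrow> c M = 0"
  shows "ring.algebraically_independent mero rational_functions V"
  unfolding mero.algebraically_independent_def
proof (intro ballI impI)
  fix P assume P: "P \<in> mero.indexed_pset V rational_functions" and zero: "mero.indexed_subst P = \<zero>\<^bsub>mero\<^esub>"
  define S where "S = {m. P m \<noteq> \<zero>\<^bsub>mero\<^esub>}"
  have coeff: "\<And>m. P m \<in> rational_functions" and fS: "finite S" and SV: "\<And>m. m \<in> S \<Longrightarrow> set_mset m \<subseteq> V"
    using mero.indexed_pset_coeff[OF subfieldE(1)[OF rational_functions_subfield] P] by (auto simp: S_def)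
  have "\<exists>p q. P m = remove_sings (\<lambda>z. poly p z / poly q z) \<and> q \<noteq> 0" for m
    using coeff[of m] by (auto simp: rational_functions_def)
  then obtain p q where pq: "\<And>m. P m = remove_sings (\<lambda>z. poly (p m) z / poly (q m) z)" "\<And>m. q m \<noteq> 0"
    by metis
  have Pev: "\<forall>\<^sub>F w in at z. P m w = poly (p m) w / poly (q m) w" for m z
    unfolding pq(1) by (rule eventually_remove_sings_meromorphic)
      (intro meromorphic_on_divide analytic_on_imp_meromorphic_on, auto simp: analytic_on_open intro!: holomorphic_intros)
  have Pcar: "P m \<in> carrier mero" for m
    using coeff subfieldE(3)[OF rational_functions_subfield] by blast
  have mon: "finprod mero (\<lambda>b. b [^]\<^bsub>mero\<^esub> count m b) (set_mset m) = monomial_value m" "monomial_value m holomorphic_on UNIV"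
    if "m \<in> S" for m
    using that SV hol by (intro entire_monomial; blast)+
  define c where "c m = (if m \<in> S then p m * (\<Prod>k\<in>S - {m}. q k) else 0)" for m
  have subst: "mero.indexed_subst P = finsum mero (\<lambda>m. P m \<otimes>\<^bsub>mero\<^esub> monomial_value m) S"
    unfolding mero.indexed_subst_def S_def[symmetric]
    by (rule mero.finsum_cong') (use mon Pcar entire_in_mero in auto)
  have csub: "{m. c m \<noteq> 0} \<subseteq> S" by (auto simp: c_def)
  have pval: "relation_value c w = (\<Sum>m\<in>S. poly (c m) w * monomial_value m w)" for w
    by (rule relation_value_eq[OF fS csub])
  have van: "relation_value c z = 0" for z
  proof -
    have "\<forall>\<^sub>F w in at z. finsum mero (\<lambda>m. P m \<otimes>\<^bsub>mero\<^esub> monomial_value m) S w = (\<Sum>m\<in>S. (P m \<otimes>\<^bsub>mero\<^esub> monomial_value m) w)"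
      by (rule mero_finsum_eventually[OF fS]) (use mon Pcar entire_in_mero in auto)
    moreover have "\<forall>\<^sub>F w in at z. \<forall>m\<in>S. (P m \<otimes>\<^bsub>mero\<^esub> monomial_value m) w = P m w * monomial_value m w"
      by (intro eventually_ball_finite[OF fS] ballI mero_mult_eventually Pcar entire_in_mero mon)
    moreover have "\<forall>\<^sub>F w in at z. \<forall>m\<in>S. P m w = poly (p m) w / poly (q m) w"
      by (intro eventually_ball_finite[OF fS] ballI Pev)
    moreover have "\<forall>\<^sub>F w in at z. \<forall>m\<in>S. poly (q m) w \<noteq> 0"
      by (intro eventually_ball_finite[OF fS] ballI poly_eventually_nonzero pq)
    ultimately have "\<forall>\<^sub>F w in at z. relation_value c w = 0"
    proof eventually_elim
      case (elim w)
      have "poly (c m) w * monomial_value m w = (\<Prod>k\<in>S. poly (q k) w) * (P m w * monomial_value m w)" if "m \<in> S" for m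
        using that elim(3,4) fS by (simp add: c_def poly_prod prod.remove[of S m])
      then have "relation_value c w = (\<Prod>k\<in>S. poly (q k) w) * (\<Sum>m\<in>S. P m w * monomial_value m w)"
        unfolding pval sum_distrib_left by (intro sum.cong) auto
      also have "(\<Sum>m\<in>S. P m w * monomial_value m w) = mero.indexed_subst P w"
        unfolding subst elim(1) by (intro sum.cong) (use elim(2) in auto)
      finally show ?case using zero by (simp add: mero_simps)
    qed
    then have "(relation_value c \<longlongrightarrow> 0) (at z)" by (rule tendsto_eventually)
    moreover have "(\<lambda>w. \<Sum>m\<in>S. poly (c m) w * monomial_value m w) holomorphic_on UNIV"
      using mon(2) by (intro holomorphic_intros)
    then have "continuous_on UNIV (relation_value c)"
      unfolding pval[abs_def] by (rule holomorphic_on_imp_continuous_on)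
    then have "(relation_value c \<longlongrightarrow> relation_value c z) (at z)"
      by (simp add: continuous_on_def)
    ultimately show ?thesis by (metis LIM_unique)
  qed
  have c0: "c m = 0" for m
    by (rule ind) (use csub fS SV van in \<open>auto intro: finite_subset\<close>)
  have "S = {}"
  proof (rule ccontr)
    assume "S \<noteq> {}"
    then obtain m where m: "m \<in> S" by blast
    have "(\<Prod>k\<in>S - {m}. q k) \<noteq> 0" using pq(2) fS by simp
    with c0[of m] m have "p m = 0" by (simp add: c_def)
    then have "P m = \<zero>\<^bsub>mero\<^esub>" unfolding pq(1) by (simp add: mero_simps entire_remove_sings)
    with m show False by (simp add: S_def)
  qed
  then show "P = mero.indexed_const \<zero>\<^bsub>mero\<^esub>" unfolding mero.indexed_zero_def S_def by auto
qed

section \<open>The exponential integrals\<close>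

lemma F_deriv: "(F P0 j has_field_derivative z ^ j * exp (poly P0 z)) (at z)"
proof -
  let ?f = "\<lambda>t. t ^ j * exp (poly P0 t)"
  have "?f holomorphic_on UNIV" by (intro holomorphic_intros)
  then obtain g where "\<And>x. x \<in> UNIV \<Longrightarrow> (g has_field_derivative ?f x) (at x within UNIV)"
    by (rule holomorphic_convex_primitive'[OF convex_UNIV open_UNIV]) blast
  then have g: "(g has_field_derivative ?f x) (at x)" for x by simp
  have "F P0 j w = g w - g 0" for w
    using contour_integral_primitive[of UNIV g ?f "linepath 0 w"] g
    unfolding F_def by (auto intro: contour_integral_unique)
  then have "F P0 j = (\<lambda>w. g w - g 0)" by auto
  then show ?thesis by (auto intro!: derivative_eq_intros g)
qed

lemma F_at_0 [simp]: "F P0 j 0 = 0"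
  by (simp add: F_def)

lemma F_holomorphic: "F P0 j holomorphic_on UNIV"
  using F_deriv by (auto simp: holomorphic_on_open)

abbreviation exp_poly :: "complex poly \<Rightarrow> complex \<Rightarrow> complex" where
  "exp_poly P0 \<equiv> \<lambda>z. exp (poly P0 z)"

lemma exp_poly_deriv: "(exp_poly P0 has_field_derivative poly (pderiv P0) z * exp_poly P0 z) (at z)"
  by (auto intro!: derivative_eq_intros)

text \<open>The derivatives of the \<open>F P0 j\<close> already differ at the point \<open>2\<close>, where \<open>2^j\<close> determines \<open>j\<close>.\<close>
lemma F_inj: "inj (F P0)"
proof (rule injI)
  fix i j assume "F P0 i = F P0 j"
  with F_deriv[of P0 i 2] F_deriv[of P0 j 2]
  have "(2::complex) ^ i * exp (poly P0 2) = 2 ^ j * exp (poly P0 2)"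
    by (metis DERIV_unique)
  then have "cmod (2 ^ i) = cmod (2 ^ j)" by simp
  then show "i = j" by (simp add: norm_power)
qed

text \<open>Both sides have derivative \<open>P0' exp P0\<close> and agree at \<open>0\<close>, where all the integrals vanish.\<close>
lemma exp_poly_linear_combination:
  "exp_poly P0 z = exp_poly P0 0 + (\<Sum>j<Polynomial.degree P0. poly.coeff (pderiv P0) j * F P0 j z)"
proof -
  define h where "h z = exp_poly P0 z - (\<Sum>j<Polynomial.degree P0. poly.coeff (pderiv P0) j * F P0 j z)" for z
  have "poly (pderiv P0) z = (\<Sum>j<Polynomial.degree P0. poly.coeff (pderiv P0) j * z ^ j)" for z
  proof (cases "Polynomial.degree P0 = 0")
    case True
    then show ?thesis by (simp add: pderiv_eq_0_iff[THEN iffD2])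
  next
    case False
    then have "{..Polynomial.degree (pderiv P0)} = {..<Polynomial.degree P0}"
      by (auto simp: degree_pderiv)
    then show ?thesis by (simp add: poly_altdef)
  qed
  then have *: "poly (pderiv P0) z * exp_poly P0 z =
      (\<Sum>j<Polynomial.degree P0. poly.coeff (pderiv P0) j * (z ^ j * exp_poly P0 z))" for z
    by (simp add: sum_distrib_right mult.assoc)
  have "(h has_field_derivative poly (pderiv P0) z * exp_poly P0 z -
      (\<Sum>j<Polynomial.degree P0. poly.coeff (pderiv P0) j * (z ^ j * exp_poly P0 z))) (at z)" for z
    unfolding h_def by (intro DERIV_diff exp_poly_deriv DERIV_sum DERIV_cmult F_deriv)
  then have "(h has_field_derivative 0) (at z)" for z by (simp add: *)
  then obtain k where "\<And>z. h z = k"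
    using has_field_derivative_zero_constant[OF convex_UNIV, of h] by auto
  then have "h z = h 0" by simp
  then show ?thesis by (simp add: h_def algebra_simps)
qed

lemma affine_combination_mem:
  assumes E: "subring E mero" and const: "\<And>a. (\<lambda>_. a) \<in> E"
    and f: "finite J" "\<And>j. j \<in> J \<Longrightarrow> f j \<in> E" "\<And>j. j \<in> J \<Longrightarrow> f j holomorphic_on UNIV"
  shows "(\<lambda>z. a0 + (\<Sum>j\<in>J. a j * f j z)) \<in> E"
  using f
proof (induction J)
  case empty
  then show ?case using const by simp
next
  case (insert i J)
  have hol: "(\<lambda>z. a0 + (\<Sum>j\<in>J. a j * f j z)) holomorphic_on UNIV" "(\<lambda>z. a i * f i z) holomorphic_on UNIV"
    using insert by (auto intro!: holomorphic_intros)
  have "(\<lambda>_. a i) \<otimes>\<^bsub>mero\<^esub> f i \<in> E" using subringE(6)[OF E const] insert by blast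
  then have "(\<lambda>z. a i * f i z) \<in> E" using insert by (simp add: entire_mult)
  moreover have "(\<lambda>z. a0 + (\<Sum>j\<in>J. a j * f j z)) \<in> E" using insert by blast
  ultimately have "(\<lambda>z. a i * f i z) \<oplus>\<^bsub>mero\<^esub> (\<lambda>z. a0 + (\<Sum>j\<in>J. a j * f j z)) \<in> E"
    using subringE(7)[OF E] by blast
  then show ?case using hol insert(1,2) by (simp add: entire_add algebra_simps)
qed

lemma const_rational: "(\<lambda>_. a) \<in> rational_functions"
proof -
  have "(\<lambda>_. a) = poly [:a:]" by auto
  then have "(\<lambda>_. a) \<in> polynomial_functions" unfolding polynomial_functions_def by (rule range_eqI)
  then show ?thesis unfolding rational_functions_generated by (rule generate_field.incl)
qed

lemma rational_functions_carrier: "rational_functions \<subseteq> carrier mero"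
  using subfieldE(3)[OF rational_functions_subfield] .

section \<open>The field of fractions and the transcendence degree\<close>

lemma is_fraction_field_A_K: "ring.is_fraction_field mero (A_ring P0) (K_field P0)"
  unfolding mero.is_fraction_field_def
proof (intro conjI ballI)
  let ?Fs = "F P0 ` {..<Polynomial.degree P0}"
  have Fs: "?Fs \<subseteq> carrier mero" using F_holomorphic by (auto intro: entire_in_mero)
  show A: "subring (A_ring P0) mero"
    unfolding A_ring_def using Fs polynomial_functions_closed by (intro mero.generate_ring_is_subring) auto
  show K: "subfield (K_field P0) mero"
    unfolding K_field_def using Fs rational_functions_carrier
    by (intro field.generate_field_is_subfield[OF field_mero]) auto
  have "polynomial_functions \<subseteq> rational_functions"
    unfolding rational_functions_generated by (auto intro: generate_field.incl)
  then have "polynomial_functions \<union> ?Fs \<subseteq> K_field P0"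
    unfolding K_field_def by (auto intro: generate_field.incl)
  then show "A_ring P0 \<subseteq> K_field P0"
    unfolding A_ring_def using Fs polynomial_functions_closed subfieldE(1)[OF K]
    by (intro mero.generate_ring_min_subring1) auto
  fix x assume x: "x \<in> K_field P0"
  have gen: "polynomial_functions \<union> ?Fs \<subseteq> A_ring P0"
    unfolding A_ring_def by (auto intro: generate_ring.incl)
  have one: "\<one>\<^bsub>mero\<^esub> \<in> A_ring P0 - {\<zero>\<^bsub>mero\<^esub>}"
    using subringE(3)[OF A] by (simp add: mero_simps fun_eq_iff)
  have "\<exists>a\<in>A_ring P0. \<exists>b\<in>A_ring P0 - {\<zero>\<^bsub>mero\<^esub>}. h = a \<otimes>\<^bsub>mero\<^esub> inv\<^bsub>mero\<^esub> b"
    if "h \<in> rational_functions \<union> ?Fs" for h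
  proof (cases "h \<in> ?Fs")
    case True
    then have "h = h \<otimes>\<^bsub>mero\<^esub> inv\<^bsub>mero\<^esub> \<one>\<^bsub>mero\<^esub>" using Fs by auto
    moreover have "h \<in> A_ring P0" using True gen by blast
    ultimately show ?thesis using one by (intro bexI)
  next
    case False
    with that have "h \<in> rational_functions" by blast
    then show ?thesis unfolding rational_functions_eq using gen by blast
  qed
  from field.generate_field_fractions[OF field_mero A this] x
  show "\<exists>a\<in>A_ring P0. \<exists>b\<in>A_ring P0 - {\<zero>\<^bsub>mero\<^esub>}. x = a \<otimes>\<^bsub>mero\<^esub> inv\<^bsub>mero\<^esub> b"
    unfolding K_field_def by blast
qed

lemma exponential_integrals_F:
  assumes "Polynomial.degree P0 \<ge> 1"
  shows "exponential_integrals (exp_poly P0) (F P0 ` {..<Polynomial.degree P0 - 1}) (pderiv P0)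
     (\<lambda>f. Polynomial.monom 1 (the_inv (F P0) f))"
proof
  have the_inv: "the_inv (F P0) (F P0 j) = j" for j by (rule the_inv_f_f[OF F_inj])
  show "exp_poly P0 \<notin> F P0 ` {..<Polynomial.degree P0 - 1}"
  proof
    assume "exp_poly P0 \<in> F P0 ` {..<Polynomial.degree P0 - 1}"
    then obtain j where "exp_poly P0 = F P0 j" by blast
    then have "exp_poly P0 0 = F P0 j 0" by metis
    then show False by simp
  qed
  show "pderiv P0 \<noteq> 0" using assms by (simp add: pderiv_eq_0_iff)
  show "(f has_field_derivative poly (Polynomial.monom 1 (the_inv (F P0) f)) z * exp_poly P0 z) (at z)"
    if "f \<in> F P0 ` {..<Polynomial.degree P0 - 1}" for f z
    using that F_deriv by (auto simp: the_inv poly_monom)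
  show "Polynomial.degree (Polynomial.monom (1::complex) (the_inv (F P0) f)) < Polynomial.degree (pderiv P0)"
    if "f \<in> F P0 ` {..<Polynomial.degree P0 - 1}" for f
    using that by (auto simp: the_inv Polynomial.degree_monom_eq degree_pderiv)
  show "s f = 0" if sum: "(\<Sum>f\<in>F P0 ` {..<Polynomial.degree P0 - 1}. Polynomial.smult (s f) (Polynomial.monom 1 (the_inv (F P0) f))) = 0"
    and f: "f \<in> F P0 ` {..<Polynomial.degree P0 - 1}" for s :: "(complex \<Rightarrow> complex) \<Rightarrow> complex" and f
  proof -
    obtain j where j: "f = F P0 j" "j < Polynomial.degree P0 - 1" using f by blast
    have "(\<Sum>i<Polynomial.degree P0 - 1. Polynomial.monom (s (F P0 i)) i) = 0"
      using sum by (simp add: sum.reindex inj_on_subset[OF F_inj] the_inv Polynomial.smult_monom)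
    then have "poly.coeff (\<Sum>i<Polynomial.degree P0 - 1. Polynomial.monom (s (F P0 i)) i) j = 0" by simp
    then show ?thesis using j by (simp add: coeff_sum)
  qed
qed (use exp_poly_deriv in auto)

text \<open>
  The basis consists of \<open>exp P0\<close> and all integrals but the last. The full list of integrals would
  be a basis too, but their derivatives involve \<open>exp P0\<close>, which has to be a variable for differentiation
  to act on polynomial relations.
\<close>
lemma transcendence_degree_K:
  assumes "Polynomial.degree P0 \<ge> 1"
  shows "ring.has_transcendence_degree mero rational_functions (K_field P0) (Polynomial.degree P0)"
proof -
  define d where "d = Polynomial.degree P0"
  let ?H = "F P0 ` {..<d - 1}"
  let ?B = "insert (exp_poly P0) ?H"
  interpret ei: exponential_integrals "exp_poly P0" ?H "pderiv P0" "\<lambda>f. Polynomial.monom 1 (the_inv (F P0) f)"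
    using exponential_integrals_F[OF assms] by (simp add: d_def)
  have d: "{..<d} = insert (d - 1) {..<d - 1}" using assms by (auto simp: d_def)
  have exp_poly_hol: "exp_poly P0 holomorphic_on UNIV" by (intro holomorphic_intros)
  have hol: "v holomorphic_on UNIV" if "v \<in> ?B" for v
    using that exp_poly_hol F_holomorphic by auto
  have Fcar: "F P0 j \<in> carrier mero" for j using F_holomorphic by (rule entire_in_mero)
  have K: "subfield (K_field P0) mero"
    using is_fraction_field_A_K by (simp add: mero.is_fraction_field_def)
  have RK: "rational_functions \<subseteq> K_field P0"
    unfolding K_field_def by (auto intro: generate_field.incl)
  have FK: "F P0 j \<in> K_field P0" if "j < d" for j
    using that unfolding K_field_def d_def by (auto intro: generate_field.incl)
  have "card ?B = Suc (card ?H)" using ei.G_notin_H by simp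
  also have "card ?H = d - 1" by (simp add: card_image inj_on_subset[OF F_inj])
  finally have card: "card ?B = Polynomial.degree P0" using assms by (simp add: d_def)
  have basis: "mero.transcendence_basis rational_functions (K_field P0) ?B"
    unfolding mero.transcendence_basis_def
  proof (intro conjI ballI)
    have "(\<lambda>z. exp_poly P0 0 + (\<Sum>j<d. poly.coeff (pderiv P0) j * F P0 j z)) \<in> K_field P0"
      by (rule affine_combination_mem) (use subfieldE(1)[OF K] const_rational RK FK F_holomorphic in auto)
    moreover have "exp_poly P0 = (\<lambda>z. exp_poly P0 0 + (\<Sum>j<d. poly.coeff (pderiv P0) j * F P0 j z))"
      unfolding d_def by (rule ext) (rule exp_poly_linear_combination)
    ultimately have "exp_poly P0 \<in> K_field P0" by simp
    then show "?B \<subseteq> K_field P0" using FK by auto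
    show "mero.algebraically_independent rational_functions ?B"
    proof (rule algebraically_independentI[OF hol])
      fix c M assume "finite {M. c M \<noteq> 0}" "\<And>M. c M \<noteq> 0 \<Longrightarrow> set_mset M \<subseteq> ?B" "\<And>z. relation_value c z = 0"
      then show "c M = 0" by (intro ei.no_algebraic_relation) (unfold ei.admissible_def, auto)
    qed
    let ?E = "generate_field mero (rational_functions \<union> ?B)"
    have car: "rational_functions \<union> ?B \<subseteq> carrier mero"
      using rational_functions_carrier hol entire_in_mero by blast
    have E: "subfield ?E mero" by (rule field.generate_field_is_subfield[OF field_mero car])
    have incl: "rational_functions \<union> ?B \<subseteq> ?E" by (auto intro: generate_field.incl)
    \<comment> \<open>Solve the expansion of \<open>exp P0\<close> for the last integral, whose coefficient \<open>l\<close> is the leading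
      coefficient of \<open>P0'\<close>.\<close>
    have last: "F P0 (d - 1) \<in> ?E"
    proof -
      define l where "l = poly.coeff (pderiv P0) (d - 1)"
      have l: "l \<noteq> 0" using ei.p_nonzero unfolding l_def d_def by (metis degree_pderiv leading_coeff_0_iff)
      define f where "f j = (if j = d - 1 then exp_poly P0 else F P0 j)" for j
      define a where "a j = (if j = d - 1 then 1 / l else - poly.coeff (pderiv P0) j / l)" for j
      have "(\<lambda>z. - exp_poly P0 0 / l + (\<Sum>j<d. a j * f j z)) \<in> ?E"
        by (rule affine_combination_mem)
           (use subfieldE(1)[OF E] const_rational incl F_holomorphic exp_poly_hol d in \<open>auto simp: f_def\<close>)
      moreover have "F P0 (d - 1) z = - exp_poly P0 0 / l + (\<Sum>j<d. a j * f j z)" for z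
      proof -
        have "exp_poly P0 z = exp_poly P0 0 + (l * F P0 (d - 1) z + (\<Sum>j<d - 1. poly.coeff (pderiv P0) j * F P0 j z))"
          using exp_poly_linear_combination[of P0 z] unfolding d_def[symmetric] d l_def by simp
        moreover have "(\<Sum>j<d. a j * f j z) = exp_poly P0 z / l - (\<Sum>j<d - 1. poly.coeff (pderiv P0) j * F P0 j z) / l"
          unfolding d by (simp add: a_def f_def sum_divide_distrib sum_negf)
        moreover have "x = - e0 / l + t" if "e = e0 + (l * x + s)" "t = e / l - s / l" for e e0 x s t
          using l that by (simp add: add_divide_distrib diff_divide_distrib)
        ultimately show ?thesis by blast
      qed
      then have "F P0 (d - 1) = (\<lambda>z. - exp_poly P0 0 / l + (\<Sum>j<d. a j * f j z))" by (rule ext)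
      ultimately show ?thesis by simp
    qed
    have "rational_functions \<union> F P0 ` {..<d} \<subseteq> ?E" unfolding d using incl last by auto
    then have "K_field P0 \<subseteq> ?E"
      unfolding K_field_def d_def[symmetric] using rational_functions_carrier Fcar
      by (intro field.generate_field_min_subfield1[OF field_mero _ E]) auto
    moreover fix x assume "x \<in> K_field P0"
    ultimately have "x \<in> ?E" by blast
    then show "(mero.algebraic over ?E) x"
      using domain.algebraic_self[OF field.axioms(1)[OF field_mero] subfieldE(1)[OF E]] by simp
  qed
  show ?thesis
    unfolding mero.has_transcendence_degree_def
    using rational_functions_subfield K RK basis card by (intro conjI exI[of _ ?B]) simp_all
qed

theorem mainTheorem7:
  fixes P0 :: "complex poly" and d :: nat
  assumes "Polynomial.degree P0 = d" and "d \<ge> 1"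
  shows "ring.is_fraction_field mero (A_ring P0) (K_field P0) \<and>
         ring.has_transcendence_degree mero rational_functions (K_field P0) d"
  using is_fraction_field_A_K transcendence_degree_K assms by blast

end
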